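(* Let $p$ be a prime number and let $R$ be a finite commutative ring of characteristic $p$ and order $p^N$. Let $n,r$ be positive integers and let $f_1,\dots,f_r\in R[t_1,\dots,t_n]$ be nonzero polynomials. Put $Z:=\{x\in R^n\mid f_1(x)=0,\dots,f_r(x)=0\}$. Then $$\operatorname{ord}_p(\#Z)\;\ge\;\left\lceil\frac{N\bigl(n-\sum_{j=1}^r\sigma_p(f_j)\bigr)}{\max_{1\le j\le r}\sigma_p(f_j)}\right\rceil .$$
   Context: For a non-negative integer $d$ with base-$p$ expansion $d=\sum_i a_ip^i$, $a_i\in\{0,\dots,p-1\}$, the $p$-weight is $\sigma_p(d):=\sum_i a_i$. The $p$-weight degree of a monomial term $c\,t_1^{d_1}\cdots t_n^{d_n}$ with $c\neq 0$ is $\sum_{i=1}^n\sigma_p(d_i)$, and the $p$-weight degree $\sigma_p(f)$ of a nonzero polynomial $f$ is the maximum of the $p$-weight degrees of its nonzero monomial terms. For a nonzero integer $m$, $\operatorname{ord}_p(m)$ is the exponent of the largest power of $p$ dividing $m$, and $\operatorname{ord}_p(0)=\infty$. If the maximum in the denominator is $0$ (all $f_j$ are nonzero constants), the right-hand side is read as $+\infty$. *)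

theory Defs
  imports
    "HOL-Computational_Algebra.Primes"
    "HOL-Library.Poly_Mapping"
    "HOL-Library.Cardinality"
    "HOL-Library.Extended_Real"
begin

text \<open>
  Polynomials with coefficients in \<open>'a\<close> in variables indexed by the finite type \<open>'n\<close>:
  an exponent vector is an element of \<open>'n \<Rightarrow>\<^sub>0 nat\<close>, and a polynomial maps exponent
  vectors to coefficients, almost all of which vanish.
\<close>

type_synonym ('n, 'a) mvpoly = "('n \<Rightarrow>\<^sub>0 nat) \<Rightarrow>\<^sub>0 'a"

definition mvpoly_eval :: "('n::finite, 'a::comm_ring_1) mvpoly \<Rightarrow> ('n \<Rightarrow> 'a) \<Rightarrow> 'a" where
  "mvpoly_eval f x =
     (\<Sum>m\<in>Poly_Mapping.keys f. Poly_Mapping.lookup f m * (\<Prod>i\<in>UNIV. x i ^ Poly_Mapping.lookup m i))"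

text \<open>
  The \<open>i\<close>-th digit of \<open>d\<close> in base \<open>p\<close> is \<open>(d div p ^ i) mod p\<close>. For \<open>p \<ge> 2\<close> the digits
  with \<open>i > d\<close> are zero, since \<open>d < p ^ i\<close>, so the sum over \<open>i \<le> d\<close> runs through all
  nonzero digits.
\<close>

definition p_weight :: "nat \<Rightarrow> nat \<Rightarrow> nat" where
  "p_weight p d = (\<Sum>i\<le>d. (d div p ^ i) mod p)"

definition monom_p_weight :: "nat \<Rightarrow> ('n::finite \<Rightarrow>\<^sub>0 nat) \<Rightarrow> nat" where
  "monom_p_weight p m = (\<Sum>i\<in>UNIV. p_weight p (Poly_Mapping.lookup m i))"

text \<open>Only meaningful for \<open>f \<noteq> 0\<close>: the maximum is over the support of \<open>f\<close>.\<close>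

definition p_weight_degree :: "nat \<Rightarrow> ('n::finite, 'a::zero) mvpoly \<Rightarrow> nat" where
  "p_weight_degree p f = Max (monom_p_weight p ` Poly_Mapping.keys f)"

definition ord_p :: "nat \<Rightarrow> int \<Rightarrow> ereal" where
  "ord_p p m = (if m = 0 then \<infinity> else ereal (real (multiplicity (int p) m)))"

text \<open>
  The bound \<open>\<lceil>a / b\<rceil>\<close>, possibly negative, with the convention that it is \<open>\<infinity>\<close> when the
  denominator vanishes.
\<close>

definition ceil_quotient :: "int \<Rightarrow> nat \<Rightarrow> ereal" where
  "ceil_quotient a b =
     (if b = 0 then \<infinity> else ereal (real_of_int \<lceil>real_of_int a / real b\<rceil>))"

end

theory Submission
  imports Defs "HOL-Number_Theory.Cong" "HOL-Library.FuncSet"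
begin

text \<open>
  In coordinates with respect to an additive basis of the ring over its prime field, a polynomial of
  \<open>p\<close>-weight degree \<open>d\<close> becomes \<open>N\<close> functions of ordinary degree at most \<open>d\<close> over \<open>\<int>/p\<close>,
  because the \<open>p ^ s\<close>-th power map is linear. This reduces the theorem to the
  Ax--Katz bound over the prime field, for which Wilson's elementary argument applies. Lift the functions
  to functions \<open>F\<close> on \<open>{0, \<dots>, p - 1}\<close>-vectors with values in the natural numbers, and expand
  the indicator of \<open>p dvd F\<close> in Newton form as the sum of \<open>c n * (F choose n)\<close>. By Fleck's congruence
  \<open>c n\<close> is divisible by \<open>p ^ ((n - 1) div (p - 1))\<close>, and \<open>F choose n\<close> has degree at most \<open>n * d\<close>.
  Finally, the sum of a function of degree at most \<open>D * (p - 1)\<close> over the box \<open>{0, \<dots>, p - 1}\<close> in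
  \<open>M\<close> coordinates is divisible by \<open>p ^ (M - D)\<close>.
\<close>

section \<open>Forward differences and Fleck's congruence\<close>

definition fdiff :: "(nat \<Rightarrow> int) \<Rightarrow> nat \<Rightarrow> int" where
  "fdiff g x = g (Suc x) - g x"

lemma fdiff_cmult: "fdiff (\<lambda>x. c * g x) = (\<lambda>x. c * fdiff g x)"
  by (auto simp: fdiff_def algebra_simps)

lemma fdiff_funpow_cmult: "(fdiff ^^ n) (\<lambda>x. c * g x) = (\<lambda>x. c * (fdiff ^^ n) g x)"
  by (induction n) (auto simp: fdiff_cmult)

lemma fdiff_funpow_shift: "(fdiff ^^ n) (\<lambda>x. g (y + x)) x = (fdiff ^^ n) g (y + x)"
  by (induction n arbitrary: x) (auto simp: fdiff_def)

text \<open>Induction by Pascal's rule: \<open>g (Suc x) = g x + fdiff g x\<close>, and the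
  hypothesis is applied to both \<open>g\<close> and \<open>fdiff g\<close>, so \<open>g\<close>
  must be arbitrary.\<close>

lemma newton_forward_difference:
  "g x = (\<Sum>j\<le>x. int (x choose j) * (fdiff ^^ j) g 0)"
proof (induction x arbitrary: g)
  case 0
  show ?case by simp
next
  case (Suc x)
  let ?a = "\<lambda>j. (fdiff ^^ j) g 0"
  have "g (Suc x) = g x + fdiff g x"
    by (simp add: fdiff_def)
  also have "g x = (\<Sum>j\<le>Suc x. int (x choose j) * ?a j)"
    using Suc.IH[of g] by simp
  also have "\<dots> = ?a 0 + (\<Sum>j\<le>x. int (x choose Suc j) * ?a (Suc j))"
    by (subst sum.atMost_Suc_shift) simp
  also have "fdiff g x = (\<Sum>j\<le>x. int (x choose j) * ?a (Suc j))"
    using Suc.IH[of "fdiff g"] by (simp add: funpow_swap1)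
  also have "?a 0 + (\<Sum>j\<le>x. int (x choose Suc j) * ?a (Suc j))
      + (\<Sum>j\<le>x. int (x choose j) * ?a (Suc j))
    = ?a 0 + (\<Sum>j\<le>x. int (Suc x choose Suc j) * ?a (Suc j))"
    by (simp add: sum.distrib[symmetric] algebra_simps del: funpow.simps)
  also have "\<dots> = (\<Sum>j\<le>Suc x. int (Suc x choose j) * ?a j)"
    by (subst sum.atMost_Suc_shift) simp
  finally show ?case .
qed

lemma newton_forward_difference_bound:
  assumes "x \<le> B"
  shows "g x = (\<Sum>j\<le>B. int (x choose j) * (fdiff ^^ j) g 0)"
  unfolding newton_forward_difference[of g x]
  by (rule sum.mono_neutral_left) (use assms in auto)

text \<open>Newton's expansion of the partial sums \<open>S\<close>: here \<open>fdiff S = g\<close>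
  and \<open>S 0 = 0\<close>, so the binomial index shifts by one.\<close>

lemma sum_forward_difference:
  "(\<Sum>a<m. g a) = (\<Sum>j<m. int (m choose Suc j) * (fdiff ^^ j) g 0)"
proof -
  define S where "S m = (\<Sum>a<m. g a)" for m
  have d: "fdiff S = g"
    by (auto simp: fdiff_def S_def)
  have e: "(fdiff ^^ Suc j) S = (fdiff ^^ j) g" for j
    by (simp only: funpow_Suc_right o_apply d)
  have "S m = (\<Sum>j\<le>m. int (m choose j) * (fdiff ^^ j) S 0)"
    by (rule newton_forward_difference)
  also have "\<dots> = (\<Sum>j<Suc m. int (m choose j) * (fdiff ^^ j) S 0)"
    by (simp only: lessThan_Suc_atMost)
  also have "\<dots> = S 0 + (\<Sum>j<m. int (m choose Suc j) * (fdiff ^^ Suc j) S 0)"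
    by (subst sum.lessThan_Suc_shift) simp
  also have "\<dots> = (\<Sum>j<m. int (m choose Suc j) * (fdiff ^^ j) g 0)"
    by (simp only: e) (simp add: S_def)
  finally show ?thesis
    by (simp add: S_def)
qed

lemma prime_choose_Suc:
  assumes "prime p" "Suc j < p"
  shows "int (p choose Suc j) = int p * int ((p choose Suc j) div p)"
  using dvd_choose_prime[of "Suc j" p] assms
  by (metis dvd_mult_div_cancel nat.simps(3) nat_neq_iff of_nat_mult prime_gt_0_nat)

text \<open>
  On \<open>p\<close>-periodic functions \<open>(1 + \<Delta>) ^ p = 1\<close>, and all inner binomial coefficients are divisible by \<open>p\<close>.
\<close>

lemma fdiff_funpow_prime_periodic:
  assumes p: "prime p" and per: "\<And>x. g (x + p) = g x"
  shows "\<exists>h. (\<forall>x. h (x + p) = h x) \<and> (fdiff ^^ p) g = (\<lambda>x. int p * fdiff h x)"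
proof -
  obtain q where q: "p = Suc q" "q > 0"
    using prime_gt_1_nat[OF p] by (cases p) auto
  \<comment> \<open>By periodicity, the terms of orders 1 to \<open>p\<close> in the Newton
    expansion of \<open>g (x + p)\<close> cancel. Solving for the term of order \<open>p\<close>
    gives the sign; dividing by \<open>p\<close> and taking one \<open>fdiff\<close> out of the
    others leaves \<open>h\<close>.\<close>
  define h where "h x = - (\<Sum>j<q. int ((p choose Suc j) div p) * (fdiff ^^ j) g x)" for x
  have perj: "(fdiff ^^ j) g (x + p) = (fdiff ^^ j) g x" for j x
    using fdiff_funpow_shift[of j g p x] per by (simp add: add.commute)
  have hper: "h (x + p) = h x" for x
    unfolding h_def by (simp add: perj)
  have "(fdiff ^^ p) g x = int p * fdiff h x" for x
  proof -
    have ch: "int (p choose Suc j) = int p * int ((p choose Suc j) div p)" if "j < q" for j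
      using prime_choose_Suc[OF p] that q by simp
    have "g (x + p) = (\<Sum>j\<le>p. int (p choose j) * (fdiff ^^ j) g x)"
      using newton_forward_difference[of "\<lambda>y. g (x + y)" p] by (simp add: fdiff_funpow_shift)
    also have "\<dots> = (\<Sum>j\<le>q. int (p choose Suc j) * (fdiff ^^ Suc j) g x) + g x"
      unfolding q by (subst sum.atMost_Suc_shift) simp
    also have "(\<Sum>j\<le>q. int (p choose Suc j) * (fdiff ^^ Suc j) g x)
        = (\<Sum>j<q. int (p choose Suc j) * (fdiff ^^ Suc j) g x) + (fdiff ^^ p) g x"
      by (simp add: lessThan_Suc_atMost[symmetric] q)
    also have "(\<Sum>j<q. int (p choose Suc j) * (fdiff ^^ Suc j) g x)
        = (\<Sum>j<q. int p * (int ((p choose Suc j) div p) * (fdiff ^^ Suc j) g x))"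
      by (intro sum.cong refl) (simp only: ch lessThan_iff mult.assoc)
    also have "\<dots> = - int p * fdiff h x"
      by (simp add: fdiff_def h_def sum_distrib_left[symmetric] sum_subtractf algebra_simps)
    finally show ?thesis
      using per[of x] by simp
  qed
  then show ?thesis
    using hper by blast
qed

text \<open>The spare \<open>fdiff\<close> on the right is what makes the induction run: with
  \<open>p - 1\<close> more differences it completes order \<open>p\<close> on the periodic function
  \<open>h\<close>, which yields the next factor \<open>p\<close>.\<close>

lemma fdiff_funpow_periodic:
  assumes p: "prime p" and per: "\<And>x. g (x + p) = g x"
  shows "\<exists>h. (\<forall>x. h (x + p) = h x) \<and>
    (fdiff ^^ Suc (k * (p - 1))) g = (\<lambda>x. int p ^ k * fdiff h x)"
proof (induction k)
  case 0
  show ?case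
    using per by (intro exI[of _ g]) auto
next
  case (Suc k)
  then obtain h where h: "\<forall>x. h (x + p) = h x"
    and eq: "(fdiff ^^ Suc (k * (p - 1))) g = (\<lambda>x. int p ^ k * fdiff h x)"
    by blast
  obtain h' where h': "\<forall>x. h' (x + p) = h' x"
    and eq': "(fdiff ^^ p) h = (\<lambda>x. int p * fdiff h' x)"
    using fdiff_funpow_prime_periodic[OF p, of h] h by blast
  have pp: "p = Suc (p - 1)"
    using prime_gt_0_nat[OF p] by simp
  have "(fdiff ^^ Suc (Suc k * (p - 1))) g = (fdiff ^^ (p - 1)) ((fdiff ^^ Suc (k * (p - 1))) g)"
    unfolding o_apply[symmetric, of "fdiff ^^ (p - 1)"] funpow_add[symmetric] by simp
  also have "\<dots> = (\<lambda>x. int p ^ k * (fdiff ^^ (p - 1)) (fdiff h) x)"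
    unfolding eq by (rule fdiff_funpow_cmult)
  also have "(fdiff ^^ (p - 1)) (fdiff h) = (fdiff ^^ p) h"
    by (subst (2) pp) (simp only: funpow_Suc_right o_apply)
  finally show ?case
    using h' eq' by (intro exI[of _ h']) (auto simp: mult_ac)
qed

text \<open>After the first difference, each block of \<open>p - 1\<close> differences gives a
  factor \<open>p\<close>; the leftover \<open>m\<close> differences preserve divisibility.\<close>

lemma fleck_congruence:
  assumes p: "prime p" and per: "\<And>x. g (x + p) = g x"
  shows "int p ^ ((n - 1) div (p - 1)) dvd (fdiff ^^ n) g x"
proof (cases n)
  case 0
  then show ?thesis by simp
next
  case (Suc n')
  define k m where "k = n' div (p - 1)" and "m = n' mod (p - 1)"
  have n: "n = m + Suc (k * (p - 1))"
    unfolding Suc k_def m_def using div_mult_mod_eq[of n' "p - 1"] by linarith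
  obtain h where "(fdiff ^^ Suc (k * (p - 1))) g = (\<lambda>x. int p ^ k * fdiff h x)"
    using fdiff_funpow_periodic[OF p, of g k] per by blast
  then have "(fdiff ^^ n) g x = int p ^ k * (fdiff ^^ m) (fdiff h) x"
    unfolding n funpow_add o_apply by (simp only: fdiff_funpow_cmult)
  then show ?thesis
    by (simp add: Suc k_def)
qed

section \<open>Degree of integer-valued functions via partial differences\<close>

definition pdiff :: "'i \<Rightarrow> (('i \<Rightarrow> nat) \<Rightarrow> int) \<Rightarrow> ('i \<Rightarrow> nat) \<Rightarrow> int" where
  "pdiff i F y = F (y(i := Suc (y i))) - F y"

text \<open>Degree via vanishing iterated differences admits binomial coefficients, whose polynomial
  coefficients need not be integers. Level 0 is the zero function, so \<open>deg_lt (Suc d)\<close>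
  means degree at most \<open>d\<close>.\<close>

primrec deg_lt :: "nat \<Rightarrow> (('i \<Rightarrow> nat) \<Rightarrow> int) \<Rightarrow> bool" where
  "deg_lt 0 F \<longleftrightarrow> (\<forall>y. F y = 0)"
| "deg_lt (Suc d) F \<longleftrightarrow> (\<forall>i. deg_lt d (pdiff i F))"

lemma deg_lt_zero: "deg_lt d (\<lambda>y. 0)"
proof (induction d)
  case (Suc d)
  have "pdiff i (\<lambda>y. 0) = (\<lambda>y. 0)" for i :: 'a
    by (auto simp: pdiff_def)
  with Suc show ?case by simp
qed simp

lemma deg_lt_Suc: "deg_lt d F \<Longrightarrow> deg_lt (Suc d) F"
proof (induction d arbitrary: F)
  case 0
  then have "F = (\<lambda>y. 0)" by auto
  then show ?case using deg_lt_zero by blast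
next
  case (Suc d)
  then show ?case by (metis deg_lt.simps(2))
qed

lemma deg_lt_mono:
  assumes "deg_lt d F" "d \<le> e"
  shows "deg_lt e F"
  using assms(2,1) by (induction rule: dec_induct) (auto intro: deg_lt_Suc simp del: deg_lt.simps)

lemma deg_lt_add: "deg_lt d F \<Longrightarrow> deg_lt d G \<Longrightarrow> deg_lt d (\<lambda>y. F y + G y)"
proof (induction d arbitrary: F G)
  case (Suc d)
  have "pdiff i (\<lambda>y. F y + G y) = (\<lambda>y. pdiff i F y + pdiff i G y)" for i
    by (auto simp: pdiff_def)
  with Suc show ?case by simp
qed simp

lemma deg_lt_cmult: "deg_lt d F \<Longrightarrow> deg_lt d (\<lambda>y. c * F y)"
proof (induction d arbitrary: F)
  case (Suc d)
  have "pdiff i (\<lambda>y. c * F y) = (\<lambda>y. c * pdiff i F y)" for i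
    by (auto simp: pdiff_def algebra_simps)
  with Suc show ?case by simp
qed simp

lemma deg_lt_sum:
  assumes "\<And>a. a \<in> A \<Longrightarrow> deg_lt d (F a)"
  shows "deg_lt d (\<lambda>y. \<Sum>a\<in>A. F a y)"
  using assms by (induction A rule: infinite_finite_induct) (auto intro: deg_lt_zero deg_lt_add)

lemma deg_lt_const: "deg_lt (Suc d) (\<lambda>y. c)"
  using deg_lt_zero by (auto simp: pdiff_def[abs_def])

lemma deg_lt_proj: "deg_lt (Suc (Suc d)) (\<lambda>y. int (y i))"
proof -
  have "pdiff j (\<lambda>y. int (y i)) = (\<lambda>y. if j = i then 1 else 0)" for j
    by (auto simp: pdiff_def)
  then show ?thesis
    unfolding deg_lt.simps(2)[of "Suc d"]
    using deg_lt_const[of d 0] deg_lt_const[of d 1] by (auto simp del: deg_lt.simps)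
qed

text \<open>Discrete Leibniz rule: the difference of \<open>F * G\<close> splits into two products,
  in each of which one factor has been differenced. If that factor was constant, the product
  vanishes.\<close>

lemma deg_lt_mult:
  "deg_lt (Suc a) F \<Longrightarrow> deg_lt (Suc b) G \<Longrightarrow> deg_lt (Suc (a + b)) (\<lambda>y. F y * G y)"
proof (induction "a + b" arbitrary: a b F G rule: less_induct)
  case less
  have "deg_lt (a + b) (pdiff i (\<lambda>y. F y * G y))" for i
  proof -
    have G': "deg_lt b (pdiff i G)" and F': "deg_lt a (pdiff i F)"
      using less.prems by auto
    have 1: "deg_lt (a + b) (\<lambda>y. pdiff i F y * (G y + pdiff i G y))"
    proof (cases a)
      case 0
      with F' show ?thesis by (simp add: deg_lt_zero)
    next
      case (Suc a')
      have "deg_lt (Suc b) (\<lambda>y. G y + pdiff i G y)"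
        by (rule deg_lt_add[OF less.prems(2) deg_lt_Suc[OF G']])
      with less.hyps[of a' b "pdiff i F"] F' Suc show ?thesis
        by (simp del: deg_lt.simps)
    qed
    have 2: "deg_lt (a + b) (\<lambda>y. F y * pdiff i G y)"
    proof (cases b)
      case 0
      with G' show ?thesis by (simp add: deg_lt_zero)
    next
      case (Suc b')
      with less.hyps[of a b' F "pdiff i G"] less.prems(1) G' show ?thesis
        by (simp del: deg_lt.simps)
    qed
    have "pdiff i (\<lambda>y. F y * G y) = (\<lambda>y. pdiff i F y * (G y + pdiff i G y) + F y * pdiff i G y)"
      by (auto simp: pdiff_def algebra_simps)
    with deg_lt_add[OF 1 2] show ?thesis by simp
  qed
  then show ?case by simp
qed

lemma deg_lt_cmult_cancel:
  assumes "c \<noteq> 0"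
  shows "deg_lt d (\<lambda>y. c * F y) \<Longrightarrow> deg_lt d F"
proof (induction d arbitrary: F)
  case (Suc d)
  have "pdiff i (\<lambda>y. c * F y) = (\<lambda>y. c * pdiff i F y)" for i
    by (auto simp: pdiff_def algebra_simps)
  with Suc show ?case by simp
qed (use assms in simp)

text \<open>\<open>fact n\<close> times the binomial coefficient is a product of \<open>n\<close> functions of degree at most \<open>d\<close>.\<close>

lemma deg_lt_choose:
  fixes F :: "('i \<Rightarrow> nat) \<Rightarrow> nat"
  assumes F: "deg_lt (Suc d) (\<lambda>y. int (F y))"
  shows "deg_lt (Suc (n * d)) (\<lambda>y. int (F y choose n))"
proof -
  have "deg_lt (Suc (n * d)) (\<lambda>y. \<Prod>i<n. int (F y) - int i)"
  proof (induction n)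
    case 0
    show ?case using deg_lt_const[of 0 1] by simp
  next
    case (Suc n)
    have "deg_lt (Suc d) (\<lambda>y. int (F y) + (- int n))"
      by (intro deg_lt_add F deg_lt_const)
    from deg_lt_mult[OF Suc this] show ?case
      by (simp del: deg_lt.simps add: add.commute)
  qed
  moreover have "(\<Prod>i<n. int m - int i) = fact n * int (m choose n)" for m
  proof -
    have "real_of_int (\<Prod>i<n. int m - int i) = real_of_int (fact n * int (m choose n))"
      by (simp add: binomial_gbinomial gbinomial_mult_fact lessThan_atLeast0)
    then show ?thesis
      by (simp only: of_int_eq_iff)
  qed
  ultimately have "deg_lt (Suc (n * d)) (\<lambda>y. fact n * int (F y choose n))"
    by simp
  then show ?thesis
    by (rule deg_lt_cmult_cancel[rotated]) simp
qed

lemma deg_lt_pdiff: "deg_lt d F \<Longrightarrow> deg_lt d (pdiff i F)"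
  using deg_lt_Suc by fastforce

lemma deg_lt_pdiff_funpow: "deg_lt (k + d) F \<Longrightarrow> deg_lt d ((pdiff i ^^ k) F)"
  by (induction k arbitrary: F) (auto simp: funpow_swap1)

lemma deg_lt_pdiff_funpow_same: "deg_lt d F \<Longrightarrow> deg_lt d ((pdiff i ^^ k) F)"
  by (induction k) (auto intro: deg_lt_pdiff)

lemma deg_lt_fix_coordinate: "deg_lt d F \<Longrightarrow> deg_lt d (\<lambda>y. F (y(i := c)))"
proof (induction d arbitrary: F)
  case (Suc d)
  have "deg_lt d (pdiff j (\<lambda>y. F (y(i := c))))" for j
  proof (cases "j = i")
    case True
    then have "pdiff j (\<lambda>y. F (y(i := c))) = (\<lambda>y. 0)"
      by (auto simp: pdiff_def)
    then show ?thesis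
      by (simp only: deg_lt_zero)
  next
    case False
    then have "pdiff j (\<lambda>y. F (y(i := c))) = (\<lambda>y. pdiff j F (y(i := c)))"
      by (auto simp: pdiff_def fun_upd_twist)
    then show ?thesis
      using Suc by (simp del: fun_upd_apply)
  qed
  then show ?case
    by (simp del: fun_upd_apply)
qed simp

lemma fdiff_funpow_line:
  "(fdiff ^^ n) (\<lambda>a. F (y(i := a))) a = (pdiff i ^^ n) F (y(i := a))"
  by (induction n arbitrary: a) (auto simp: fdiff_def pdiff_def)

section \<open>Counting common zeros modulo a prime in a box\<close>

text \<open>
  Summing over one coordinate is the operator that sends \<open>H\<close> to the sum of
  \<open>(p choose (j + 1)) * \<Delta>\<^sup>j H\<close> over \<open>j < p\<close>: every term either carries a factor \<open>p\<close> or lowers the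
  degree by \<open>p - 1\<close>.
\<close>

lemma box_sum_dvd:
  fixes H :: "('i \<Rightarrow> nat) \<Rightarrow> int" and I :: "'i set"
  assumes p: "prime p" and "finite I" and "deg_lt (Suc (D * (p - 1))) H"
  shows "int p ^ (card I - D) dvd (\<Sum>y\<in>PiE I (\<lambda>_. {..<p}). H y)"
  using assms(2,3)
proof (induction I arbitrary: H D rule: finite_induct)
  case empty
  then show ?case by simp
next
  case (insert i I)
  obtain q where q: "p = Suc q" "q > 0"
    using prime_gt_1_nat[OF p] by (cases p) auto
  let ?B = "PiE I (\<lambda>_. {..<p})"
  \<comment> \<open>\<open>H1\<close> collects the orders below \<open>q = p - 1\<close>, with
    \<open>p\<close> divided out of the binomial coefficients; \<open>H2\<close> is the term of
    order \<open>q\<close>, with coefficient 1.\<close>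
  define H1 where "H1 y = (\<Sum>j<q. int ((p choose Suc j) div p) * (pdiff i ^^ j) H (y(i := 0)))" for y
  define H2 where "H2 y = (pdiff i ^^ q) H (y(i := 0))" for y
  have ch: "int (p choose Suc j) = int p * int ((p choose Suc j) div p)" if "j < q" for j
    using prime_choose_Suc[OF p] that q by simp
  have split: "(\<Sum>a<p. H (y(i := a))) = int p * H1 y + H2 y" for y
  proof -
    have "(\<Sum>a<p. H (y(i := a))) = (\<Sum>j<p. int (p choose Suc j) * (pdiff i ^^ j) H (y(i := 0)))"
      by (subst sum_forward_difference) (simp only: fdiff_funpow_line)
    also have "\<dots> = (\<Sum>j<q. int (p choose Suc j) * (pdiff i ^^ j) H (y(i := 0))) + H2 y"
      by (simp add: q H2_def)
    also have "(\<Sum>j<q. int (p choose Suc j) * (pdiff i ^^ j) H (y(i := 0)))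
      = (\<Sum>j<q. int p * (int ((p choose Suc j) div p) * (pdiff i ^^ j) H (y(i := 0))))"
      by (intro sum.cong refl) (simp only: ch lessThan_iff mult.assoc)
    finally show ?thesis
      by (simp add: H1_def sum_distrib_left del: fun_upd_apply)
  qed
  have "(\<Sum>y\<in>PiE (insert i I) (\<lambda>_. {..<p}). H y) = (\<Sum>(a, y)\<in>{..<p} \<times> ?B. H (y(i := a)))"
    unfolding PiE_insert_eq
    using inj_combinator[OF insert.hyps(2), of "\<lambda>_. {..<p}"]
    by (subst sum.reindex) (auto simp: case_prod_unfold)
  also have "\<dots> = (\<Sum>y\<in>?B. \<Sum>a<p. H (y(i := a)))"
    by (subst sum.cartesian_product[symmetric]) (rule sum.swap)
  also have "\<dots> = int p * (\<Sum>y\<in>?B. H1 y) + (\<Sum>y\<in>?B. H2 y)"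
    by (simp add: split sum.distrib sum_distrib_left)
  finally have eq: "(\<Sum>y\<in>PiE (insert i I) (\<lambda>_. {..<p}). H y)
    = int p * (\<Sum>y\<in>?B. H1 y) + (\<Sum>y\<in>?B. H2 y)" .
  \<comment> \<open>For \<open>H1\<close> the lost coordinate is paid for by the explicit factor
    \<open>p\<close>; for \<open>H2\<close> it is paid for by lowering \<open>D\<close>.\<close>
  have "deg_lt (Suc (D * (p - 1))) H1"
    unfolding H1_def[abs_def]
    by (intro deg_lt_sum deg_lt_cmult deg_lt_fix_coordinate deg_lt_pdiff_funpow_same insert.prems)
  then have "int p * int p ^ (card I - D) dvd int p * (\<Sum>y\<in>?B. H1 y)"
    by (intro mult_dvd_mono insert.IH) auto
  then have 1: "int p ^ (card (insert i I) - D) dvd int p * (\<Sum>y\<in>?B. H1 y)"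
    using insert.hyps by (elim dvd_trans[rotated]) (auto intro: le_imp_power_dvd simp flip: power_Suc)
  have 2: "int p ^ (card (insert i I) - D) dvd (\<Sum>y\<in>?B. H2 y)"
  proof (cases D)
    case 0
    \<comment> \<open>Now \<open>H\<close> has degree at most 0, and \<open>q > 0\<close>
      differences annihilate it.\<close>
    have "deg_lt (q + 0) H"
      using insert.prems 0 q by (elim deg_lt_mono) simp
    then have "deg_lt 0 ((pdiff i ^^ q) H)"
      by (rule deg_lt_pdiff_funpow)
    then show ?thesis by (simp add: H2_def)
  next
    case (Suc D')
    have "deg_lt (Suc (D' * (p - 1))) H2"
      unfolding H2_def[abs_def]
      using insert.prems Suc q
      by (intro deg_lt_fix_coordinate deg_lt_pdiff_funpow) (simp del: deg_lt.simps add: add_ac)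
    then show ?thesis
      using insert.IH Suc insert.hyps by simp
  qed
  show ?case
    unfolding eq by (rule dvd_add[OF 1 2])
qed

text \<open>
  The weight \<open>H\<close> and the factor \<open>p ^ k\<close> absorb, one member of \<open>T\<close> at a time, the binomial coefficient
  and the power of \<open>p\<close> from the Newton expansion of the indicator of divisibility by \<open>p\<close>.
  A term of order \<open>n\<close> raises \<open>k\<close> by \<open>s = (n - 1) div (p - 1)\<close> and \<open>D\<close> by at most \<open>(s + 1) * d t\<close>.
\<close>

lemma weighted_box_zero_count_dvd:
  fixes F :: "'t \<Rightarrow> ('i \<Rightarrow> nat) \<Rightarrow> nat" and H :: "('i \<Rightarrow> nat) \<Rightarrow> int"
  assumes p: "prime p" and I: "finite I" and "finite T" and "m > 0"
    and "\<And>t. t \<in> T \<Longrightarrow> deg_lt (Suc (d t)) (\<lambda>y. int (F t y))"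
    and "\<And>t. t \<in> T \<Longrightarrow> d t \<le> m"
    and "deg_lt (Suc (D * (p - 1))) H"
    and "k < q \<Longrightarrow> D + (\<Sum>t\<in>T. d t) + m * (q - 1 - k) < card I"
  shows "int p ^ q dvd
    int p ^ k * (\<Sum>y\<in>PiE I (\<lambda>_. {..<p}). H y * (\<Prod>t\<in>T. of_bool (p dvd F t y)))"
  using assms(3,5-)
proof (induction T arbitrary: H D k rule: finite_induct)
  case empty
  have "int p ^ q dvd int p ^ k * int p ^ (card I - D)"
  proof (cases "k < q")
    case True
    \<comment> \<open>With no equations left, \<open>m > 0\<close> turns the budget into the
      exponent bound needed for \<open>box_sum_dvd\<close>.\<close>
    have "q - 1 - k \<le> m * (q - 1 - k)"
      using \<open>m > 0\<close> by simp
    with empty(4)[OF True] have "D + (q - 1 - k) < card I"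
      by linarith
    with True have "q \<le> k + (card I - D)"
      by arith
    then show ?thesis
      by (simp flip: power_add add: le_imp_power_dvd)
  next
    case False
    then show ?thesis
      by (simp flip: power_add add: le_imp_power_dvd)
  qed
  also have "\<dots> dvd int p ^ k * (\<Sum>y\<in>PiE I (\<lambda>_. {..<p}). H y)"
    by (rule mult_dvd_mono[OF dvd_refl box_sum_dvd[OF p I empty(3)]])
  finally show ?case by simp
next
  case (insert t T)
  let ?B = "PiE I (\<lambda>_. {..<p})"
  let ?P = "\<lambda>y. \<Prod>t\<in>T. of_bool (p dvd F t y) :: int"
  define \<delta> :: "nat \<Rightarrow> int" where "\<delta> x = of_bool (p dvd x)" for x
  define c where "c n = (fdiff ^^ n) \<delta> 0" for n
  \<comment> \<open>A common bound for the values on the box gives every Newton expansion the same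
    range, so the sums can be swapped.\<close>
  define b where "b = Max (F t ` ?B)"
  have fin: "finite ?B"
    using I by (intro finite_PiE) auto
  have newton: "\<delta> (F t y) = (\<Sum>n\<le>b. int (F t y choose n) * c n)" if "y \<in> ?B" for y
    unfolding c_def using that fin
    by (intro newton_forward_difference_bound) (auto simp: b_def)
  have c: "int p ^ ((n - 1) div (p - 1)) dvd c n" for n
    unfolding c_def by (rule fleck_congruence[OF p]) (simp add: \<delta>_def)
  have "(\<Sum>y\<in>?B. H y * (\<Prod>t\<in>insert t T. of_bool (p dvd F t y)))
    = (\<Sum>y\<in>?B. \<Sum>n\<le>b. c n * (H y * int (F t y choose n) * ?P y))"
    using insert.hyps newton
    by (intro sum.cong refl)
       (simp add: \<delta>_def sum_distrib_left sum_distrib_right mult_ac)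
  also have "\<dots> = (\<Sum>n\<le>b. c n * (\<Sum>y\<in>?B. H y * int (F t y choose n) * ?P y))"
    by (subst sum.swap) (simp add: sum_distrib_left)
  finally have eq: "int p ^ k * (\<Sum>y\<in>?B. H y * (\<Prod>t\<in>insert t T. of_bool (p dvd F t y)))
    = (\<Sum>n\<le>b. int p ^ k * (c n * (\<Sum>y\<in>?B. H y * int (F t y choose n) * ?P y)))"
    by (simp add: sum_distrib_left)
  have "int p ^ q dvd int p ^ k * (c n * (\<Sum>y\<in>?B. H y * int (F t y choose n) * ?P y))" for n
  proof -
    define s where "s = (n - 1) div (p - 1)"
    have p1: "p - 1 > 0"
      using prime_gt_1_nat[OF p] by simp
    have "n - 1 = s * (p - 1) + (n - 1) mod (p - 1)"
      unfolding s_def by (rule div_mult_mod_eq[symmetric])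
    \<comment> \<open>This also covers \<open>n = 0\<close>, where \<open>n - 1\<close> is
      truncated.\<close>
    then have n: "n \<le> (s + 1) * (p - 1)"
      using mod_less_divisor[OF p1, of "n - 1"] unfolding add_mult_distrib by linarith
    have "deg_lt (Suc (D * (p - 1) + n * d t)) (\<lambda>y. H y * int (F t y choose n))"
      by (intro deg_lt_mult deg_lt_choose insert.prems) auto
    moreover have "n * d t \<le> (s + 1) * (p - 1) * d t"
      using n by (rule mult_right_mono) simp
    ultimately have deg: "deg_lt (Suc ((D + (s + 1) * d t) * (p - 1))) (\<lambda>y. H y * int (F t y choose n))"
      by (elim deg_lt_mono) (simp add: algebra_simps)
    \<comment> \<open>Raising \<open>k\<close> by \<open>s\<close> frees \<open>m * s\<close>, which
      pays for \<open>s * d t\<close>; the remaining \<open>d t\<close> is the summand of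
      \<open>t\<close> in the old budget.\<close>
    have bd: "D + (s + 1) * d t + (\<Sum>t\<in>T. d t) + m * (q - 1 - (k + s)) < card I" if "k + s < q"
    proof -
      have "s * d t \<le> s * m"
        using insert.prems(2)[of t] by simp
      moreover have "q - 1 - k = s + (q - 1 - (k + s))"
        using that by simp
      then have "m * (q - 1 - k) = s * m + m * (q - 1 - (k + s))"
        by (metis add_mult_distrib2 mult.commute)
      moreover have "D + (d t + (\<Sum>t\<in>T. d t)) + m * (q - 1 - k) < card I"
        using insert.prems(4) that insert.hyps by simp
      ultimately show ?thesis
        unfolding add_mult_distrib by linarith
    qed
    have "int p ^ q dvd int p ^ (k + s) * (\<Sum>y\<in>?B. (H y * int (F t y choose n)) * ?P y)"
      by (rule insert.IH[OF _ _ deg bd]) (use insert.prems in auto)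
    also have "\<dots> dvd int p ^ k * (c n * (\<Sum>y\<in>?B. H y * int (F t y choose n) * ?P y))"
      unfolding power_add mult.assoc[of "int p ^ k"] s_def
      by (intro mult_dvd_mono c) auto
    finally show ?thesis .
  qed
  then show ?case
    unfolding eq by (intro dvd_sum)
qed

text \<open>Weight 1 with \<open>D = 0\<close> and \<open>k = 0\<close>: the product of indicators
  counts common zeros. The last hypothesis is the integral form of
  \<open>q - 1 < (card I - sum of d) / m\<close>.\<close>

lemma box_zero_count_dvd:
  fixes F :: "'t \<Rightarrow> ('i \<Rightarrow> nat) \<Rightarrow> nat" and I :: "'i set"
  assumes p: "prime p" and I: "finite I" and "finite T" and "m > 0"
    and "\<And>t. t \<in> T \<Longrightarrow> deg_lt (Suc (d t)) (\<lambda>y. int (F t y))"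
    and "\<And>t. t \<in> T \<Longrightarrow> d t \<le> m"
    and "q > 0 \<Longrightarrow> (\<Sum>t\<in>T. d t) + m * (q - 1) < card I"
  shows "p ^ q dvd card {y \<in> PiE I (\<lambda>_. {..<p}). \<forall>t\<in>T. p dvd F t y}"
proof -
  let ?B = "PiE I (\<lambda>_. {..<p})"
  have fin: "finite ?B"
    using I by (intro finite_PiE) auto
  have "int p ^ q dvd int p ^ 0 * (\<Sum>y\<in>?B. 1 * (\<Prod>t\<in>T. of_bool (p dvd F t y)))"
    by (rule weighted_box_zero_count_dvd[where D = 0 and m = m and d = d])
       (use assms deg_lt_const[of 0 1] in auto)
  also have "int p ^ 0 * (\<Sum>y\<in>?B. 1 * (\<Prod>t\<in>T. of_bool (p dvd F t y)))
    = (\<Sum>y\<in>?B. of_bool (\<forall>t\<in>T. p dvd F t y))"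
    using \<open>finite T\<close> by (auto intro!: sum.cong simp: of_bool_def)
  also have "\<dots> = int (card {y \<in> ?B. \<forall>t\<in>T. p dvd F t y})"
    using fin by (simp add: sum.If_cases of_bool_def Int_def)
  finally show ?thesis
    unfolding of_nat_power[symmetric] of_nat_dvd_iff .
qed

section \<open>Integral lifts of functions with values in the ring\<close>

text \<open>
  The ring elements themselves serve as a (redundant) spanning set over the prime field, and the
  coefficients are natural-number-valued so that binomial coefficients can be formed from them.
\<close>

definition lift_deg :: "nat \<Rightarrow> (('i \<Rightarrow> nat) \<Rightarrow> 'a::{comm_ring_1, finite}) \<Rightarrow> bool" where
  "lift_deg d g \<longleftrightarrow> (\<exists>F :: 'a \<Rightarrow> ('i \<Rightarrow> nat) \<Rightarrow> nat.
     (\<forall>c. deg_lt (Suc d) (\<lambda>y. int (F c y))) \<and> (\<forall>y. g y = (\<Sum>c\<in>UNIV. of_nat (F c y) * c)))"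

lemma lift_deg_cmult:
  fixes c :: "'a::{comm_ring_1, finite}"
  assumes "deg_lt (Suc d) (\<lambda>y. int (G y))"
  shows "lift_deg d (\<lambda>y. of_nat (G y) * c)"
  unfolding lift_deg_def
proof (intro exI conjI allI)
  \<comment> \<open>The witness puts the whole coefficient on the spanning element \<open>c\<close>
    itself.\<close>
  show "deg_lt (Suc d) (\<lambda>y. int (if c' = c then G y else 0))" for c'
    using assms deg_lt_zero[of "Suc d"] by (cases "c' = c") (auto simp del: deg_lt.simps)
  show "of_nat (G y) * c = (\<Sum>c'\<in>UNIV. of_nat (if c' = c then G y else 0) * c')" for y
    by (simp add: if_distrib[of of_nat] if_distrib[of "\<lambda>x. x * _"] cong: if_cong)
qed

lemma lift_deg_add:
  assumes "lift_deg d g" "lift_deg d h"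
  shows "lift_deg d (\<lambda>y. g y + h y)"
proof -
  obtain F where F: "\<And>c. deg_lt (Suc d) (\<lambda>y. int (F c y))" "\<And>y. g y = (\<Sum>c\<in>UNIV. of_nat (F c y) * c)"
    using assms(1) unfolding lift_deg_def by blast
  obtain G where G: "\<And>c. deg_lt (Suc d) (\<lambda>y. int (G c y))" "\<And>y. h y = (\<Sum>c\<in>UNIV. of_nat (G c y) * c)"
    using assms(2) unfolding lift_deg_def by blast
  show ?thesis
    unfolding lift_deg_def
  proof (intro exI conjI allI)
    show "deg_lt (Suc d) (\<lambda>y. int (F c y + G c y))" for c
      using deg_lt_add[OF F(1) G(1)] by (simp del: deg_lt.simps)
    show "g y + h y = (\<Sum>c\<in>UNIV. of_nat (F c y + G c y) * c)" for y
      by (simp add: F(2) G(2) sum.distrib algebra_simps)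
  qed
qed

lemma lift_deg_const: "lift_deg d (\<lambda>y. c)"
  using lift_deg_cmult[of d "\<lambda>_. 1" c] deg_lt_const[of d 1] by (simp del: deg_lt.simps)

lemma lift_deg_sum:
  assumes "\<And>a. a \<in> A \<Longrightarrow> lift_deg d (g a)"
  shows "lift_deg d (\<lambda>y. \<Sum>a\<in>A. g a y)"
  using assms by (induction A rule: infinite_finite_induct) (simp_all add: lift_deg_const lift_deg_add)

lemma lift_deg_mono:
  assumes "lift_deg d g" "d \<le> e"
  shows "lift_deg e g"
proof -
  have "deg_lt (Suc e) F" if "deg_lt (Suc d) F" for F :: "('a \<Rightarrow> nat) \<Rightarrow> int"
    using deg_lt_mono[OF that] assms(2) by (simp del: deg_lt.simps)
  then show ?thesis
    using assms(1) unfolding lift_deg_def by blast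
qed

text \<open>Each product \<open>c * c'\<close> is itself a member of the spanning set, so no
  structure constants are needed.\<close>

lemma lift_deg_mult:
  assumes "lift_deg a g" "lift_deg b h"
  shows "lift_deg (a + b) (\<lambda>y. g y * h y)"
proof -
  obtain F where F: "\<And>c. deg_lt (Suc a) (\<lambda>y. int (F c y))" "\<And>y. g y = (\<Sum>c\<in>UNIV. of_nat (F c y) * c)"
    using assms(1) unfolding lift_deg_def by blast
  obtain G where G: "\<And>c. deg_lt (Suc b) (\<lambda>y. int (G c y))" "\<And>y. h y = (\<Sum>c\<in>UNIV. of_nat (G c y) * c)"
    using assms(2) unfolding lift_deg_def by blast
  have "lift_deg (a + b) (\<lambda>y. \<Sum>c\<in>UNIV. \<Sum>c'\<in>UNIV. of_nat (F c y * G c' y) * (c * c'))"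
    using deg_lt_mult[OF F(1) G(1)]
    by (intro lift_deg_sum lift_deg_cmult) (simp del: deg_lt.simps)
  then show ?thesis
    by (simp add: F(2) G(2) sum_product mult_ac)
qed

lemma lift_deg_power:
  assumes "lift_deg d g"
  shows "lift_deg (n * d) (\<lambda>y. g y ^ n)"
proof (induction n)
  case (Suc n)
  then show ?case
    using lift_deg_mult[OF assms Suc] by simp
qed (simp add: lift_deg_const)

lemma lift_deg_prod:
  assumes "finite A" "\<And>a. a \<in> A \<Longrightarrow> lift_deg (d a) (g a)"
  shows "lift_deg (\<Sum>a\<in>A. d a) (\<lambda>y. \<Prod>a\<in>A. g a y)"
  using assms by (induction A rule: finite_induct) (simp_all add: lift_deg_const lift_deg_mult)

section \<open>Frobenius, base-\<open>p\<close> digits and \<open>p\<close>-weight degree\<close>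

lemma of_nat_power_char_power:
  fixes p :: nat
  assumes "prime p" "CHAR('a::comm_ring_1) = p"
  shows "of_nat m ^ (p ^ s) = (of_nat m :: 'a)"
proof (induction m)
  case 0
  then show ?case using prime_gt_0_nat[OF assms(1)] by (simp add: zero_power)
next
  case (Suc m)
  then show ?case
    using freshmans_dream'[of "p ^ s" s "1 :: 'a" "of_nat m"] assms by simp
qed

text \<open>The first \<open>k\<close> digits give \<open>d mod p ^ k\<close>, and
  \<open>d < p ^ Suc d\<close> shows that the indices up to \<open>d\<close> suffice.\<close>

lemma sum_base_digits:
  fixes p d :: nat
  assumes "p > 1"
  shows "(\<Sum>i\<le>d. (d div p ^ i) mod p * p ^ i) = d"
proof -
  have "(\<Sum>i<k. (d div p ^ i) mod p * p ^ i) = d mod p ^ k" for k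
  proof (induction k)
    case (Suc k)
    have "d mod p ^ Suc k = (d div p ^ k) mod p * p ^ k + d mod p ^ k"
      unfolding power_Suc2 mod_mult2_eq by (simp add: mult.commute)
    then show ?case
      using Suc.IH by (simp only: sum.lessThan_Suc add.commute)
  qed simp
  moreover have "d < p ^ Suc d"
  proof -
    have "d < 2 ^ d"
      by (rule less_exp)
    also have "\<dots> \<le> p ^ d"
      using assms by (intro power_mono) auto
    also have "\<dots> \<le> p ^ Suc d"
      using assms by simp
    finally show ?thesis .
  qed
  ultimately show ?thesis
    by (metis lessThan_Suc_atMost mod_less)
qed

text \<open>
  Frobenius is additive and fixes the prime field, so the \<open>p ^ s\<close>-th power of a linear form in the
  coordinates is again a linear form; only the digits of \<open>d\<close> contribute to the degree.
\<close>

lemma lift_deg_linear_form_power: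
  fixes b :: "nat \<Rightarrow> 'a::{comm_ring_1, finite}"
  assumes p: "prime p" and char: "CHAR('a) = p"
  shows "lift_deg (p_weight p d) (\<lambda>y. (\<Sum>k<N. of_nat (y (v, k)) * b k) ^ d)"
proof -
  let ?x = "\<lambda>y. \<Sum>k<N. of_nat (y (v, k)) * b k"
  have "?x y ^ (p ^ s) = (\<Sum>k<N. of_nat (y (v, k)) * b k ^ (p ^ s))" for y s
    using freshmans_dream_sum'[of "p ^ s" s "\<lambda>k. of_nat (y (v, k)) * b k" "{..<N}"] p char
    by (simp add: power_mult_distrib of_nat_power_char_power)
  then have "lift_deg 1 (\<lambda>y. ?x y ^ (p ^ s))" for s
    using deg_lt_proj[of 0] by (auto intro!: lift_deg_sum lift_deg_cmult simp del: deg_lt.simps)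
  \<comment> \<open>Factor the \<open>d\<close>-th power along the digits of \<open>d\<close>: each
    Frobenius power has degree 1 and occurs as often as its digit.\<close>
  then have "lift_deg (\<Sum>s\<le>d. (d div p ^ s) mod p * 1)
      (\<lambda>y. \<Prod>s\<le>d. (?x y ^ (p ^ s)) ^ ((d div p ^ s) mod p))"
    by (intro lift_deg_prod lift_deg_power) auto
  also have "(\<lambda>y. \<Prod>s\<le>d. (?x y ^ (p ^ s)) ^ ((d div p ^ s) mod p)) = (\<lambda>y. ?x y ^ d)"
    using sum_base_digits[of p d] prime_gt_1_nat[OF p]
    by (simp add: power_mult[symmetric] power_sum[symmetric] mult.commute)
  finally show ?thesis
    by (simp add: p_weight_def)
qed

lemma lift_deg_mvpoly_eval:
  fixes b :: "nat \<Rightarrow> 'a::{comm_ring_1, finite}" and f :: "('n::finite, 'a) mvpoly"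
  assumes p: "prime p" and char: "CHAR('a) = p"
  shows "lift_deg (p_weight_degree p f)
    (\<lambda>y. mvpoly_eval f (\<lambda>v. \<Sum>k<N. of_nat (y (v, k)) * b k))"
proof -
  let ?x = "\<lambda>y v. \<Sum>k<N. of_nat (y (v, k)) * b k"
  have "lift_deg (p_weight_degree p f)
    (\<lambda>y. Poly_Mapping.lookup f m * (\<Prod>v\<in>UNIV. ?x y v ^ Poly_Mapping.lookup m v))"
    if m: "m \<in> Poly_Mapping.keys f" for m
  proof -
    have "lift_deg (0 + monom_p_weight p m)
      (\<lambda>y. Poly_Mapping.lookup f m * (\<Prod>v\<in>UNIV. ?x y v ^ Poly_Mapping.lookup m v))"
      unfolding monom_p_weight_def
      by (intro lift_deg_mult lift_deg_const lift_deg_prod lift_deg_linear_form_power p char) simp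
    moreover have "monom_p_weight p m \<le> p_weight_degree p f"
      unfolding p_weight_degree_def using m by (intro Max_ge) auto
    ultimately show ?thesis
      by (auto intro: lift_deg_mono)
  qed
  then show ?thesis
    unfolding mvpoly_eval_def by (rule lift_deg_sum)
qed

section \<open>Coordinates over the prime field\<close>

lemma of_nat_mod_CHAR: "of_nat (m mod CHAR('a)) = (of_nat m :: 'a::comm_ring_1)"
  by (simp add: of_nat_eq_iff_cong_CHAR cong_def)

text \<open>Basis extension by counting: \<open>k\<close> elements span at most
  \<open>p ^ k < p ^ N\<close> elements, so some \<open>c\<close> lies outside their span and can be
  adjoined.\<close>

lemma exists_independent_family:
  assumes p: "prime p" and char: "CHAR('a::{comm_ring_1, finite}) = p"
    and card: "CARD('a) = p ^ N" and "k \<le> N"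
  shows "\<exists>b :: nat \<Rightarrow> 'a.
    inj_on (\<lambda>y. \<Sum>l<k. of_nat (y l) * b l) (PiE {..<k} (\<lambda>_. {..<p}))"
  using \<open>k \<le> N\<close>
proof (induction k)
  case 0
  then show ?case by simp
next
  case (Suc k)
  then obtain b :: "nat \<Rightarrow> 'a" where
    inj: "inj_on (\<lambda>y. \<Sum>l<k. of_nat (y l) * b l) (PiE {..<k} (\<lambda>_. {..<p}))"
    by auto
  have p1: "p > 1"
    using prime_gt_1_nat[OF p] .
  define S where "S = range (\<lambda>y :: nat \<Rightarrow> nat. \<Sum>l<k. of_nat (y l) * b l)"
  have "S \<subseteq> (\<lambda>y. \<Sum>l<k. of_nat (y l) * b l) ` PiE {..<k} (\<lambda>_. {..<p})"
  proof
    fix s assume "s \<in> S"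
    then obtain y :: "nat \<Rightarrow> nat" where s: "s = (\<Sum>l<k. of_nat (y l) * b l)"
      unfolding S_def by blast
    show "s \<in> (\<lambda>y. \<Sum>l<k. of_nat (y l) * b l) ` PiE {..<k} (\<lambda>_. {..<p})"
      using p1 by (intro image_eqI[of _ _ "restrict (\<lambda>l. y l mod p) {..<k}"])
        (auto simp: s of_nat_mod_CHAR[where 'a = 'a, unfolded char])
  qed
  then have "card S \<le> card ((\<lambda>y. \<Sum>l<k. of_nat (y l) * b l) ` PiE {..<k} (\<lambda>_. {..<p}))"
    by (intro card_mono finite_imageI finite_PiE) auto
  also have "\<dots> = p ^ k"
    using inj by (simp add: card_image card_PiE)
  also have "\<dots> < p ^ N"
    using Suc.prems p1 by (intro power_strict_increasing) auto
  finally have "S \<noteq> UNIV"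
    using card by auto
  then obtain c where c: "c \<notin> S"
    by blast
  \<comment> \<open>Natural coefficients suffice for differences because \<open>p - 1\<close>
    represents -1.\<close>
  have span_closed: "of_nat m * (s - s') \<in> S" if "s \<in> S" "s' \<in> S" for s s' m
  proof -
    obtain y :: "nat \<Rightarrow> nat" where "s = (\<Sum>l<k. of_nat (y l) * b l)"
      using \<open>s \<in> S\<close> unfolding S_def by blast
    moreover obtain y' :: "nat \<Rightarrow> nat" where "s' = (\<Sum>l<k. of_nat (y' l) * b l)"
      using \<open>s' \<in> S\<close> unfolding S_def by blast
    moreover have "of_nat (p - 1) = (- 1 :: 'a)"
      using p1 of_nat_CHAR[where 'a = 'a] by (simp add: of_nat_diff char)
    then obtain z where "of_nat z = (- 1 :: 'a)"
      by blast
    ultimately have "of_nat m * (s - s') = (\<Sum>l<k. of_nat (m * (y l + z * y' l)) * b l)"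
      by (simp add: sum_distrib_left sum_subtractf[symmetric] algebra_simps)
    then show ?thesis
      unfolding S_def by (rule range_eqI[where x = "\<lambda>l. m * (y l + z * y' l)"])
  qed
  \<comment> \<open>If \<open>t > t'\<close>, then \<open>t - t'\<close> is invertible modulo
    \<open>p\<close>, which would put \<open>c\<close> into \<open>S\<close>. Using this in both
    directions gives equality.\<close>
  have indep: "t \<le> t'" if eq: "s + of_nat t * c = s' + of_nat t' * c" and "s \<in> S" "s' \<in> S" "t < p" "t' < p"
    for s s' t t'
  proof (rule ccontr)
    assume "\<not> t \<le> t'"
    then have "coprime (t - t') p"
      using p \<open>t < p\<close> by (metis coprime_commute diff_is_0_eq diff_le_self dvd_imp_le leD le_less_trans not_gr_zero prime_imp_coprime)
    then obtain u where "[(t - t') * u = 1] (mod p)"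
      using cong_solve_coprime_nat by (metis One_nat_def)
    then have u: "of_nat u * of_nat (t - t') = (1 :: 'a)"
      unfolding char[symmetric] of_nat_eq_iff_cong_CHAR[symmetric] by (simp add: mult.commute)
    have "s' - s = of_nat (t - t') * c"
      using eq \<open>\<not> t \<le> t'\<close> by (simp add: of_nat_diff algebra_simps)
    then have "of_nat u * (s' - s) = c"
      by (simp add: mult.assoc[symmetric] u)
    then show False
      using span_closed[OF \<open>s' \<in> S\<close> \<open>s \<in> S\<close>, of u] c by simp
  qed
  let ?b = "b(k := c)"
  have "inj_on (\<lambda>y. \<Sum>l<Suc k. of_nat (y l) * ?b l) (PiE {..<Suc k} (\<lambda>_. {..<p}))"
  proof (rule inj_onI)
    fix y y' :: "nat \<Rightarrow> nat"
    assume y: "y \<in> PiE {..<Suc k} (\<lambda>_. {..<p})" and y': "y' \<in> PiE {..<Suc k} (\<lambda>_. {..<p})"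
      and "(\<Sum>l<Suc k. of_nat (y l) * ?b l) = (\<Sum>l<Suc k. of_nat (y' l) * ?b l)"
    then have eq: "(\<Sum>l<k. of_nat (y l) * b l) + of_nat (y k) * c
      = (\<Sum>l<k. of_nat (y' l) * b l) + of_nat (y' k) * c"
      by simp
    have lt: "y k < p" "y' k < p"
      using y y' by auto
    have yk: "y k = y' k"
      using indep[OF eq _ _ lt] indep[OF eq[symmetric] _ _ lt(2,1)] by (simp add: S_def)
    have "(\<Sum>l<k. of_nat (restrict y {..<k} l) * b l) = (\<Sum>l<k. of_nat (restrict y' {..<k} l) * b l)"
      using eq yk by simp
    then have "restrict y {..<k} = restrict y' {..<k}"
      by (rule inj_onD[OF inj]) (use PiE_mem[OF y] PiE_mem[OF y'] in \<open>simp_all only: restrict_PiE_iff\<close>, auto)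
    then have "y l = y' l" if "l < k" for l
      using that by (metis lessThan_iff restrict_apply')
    with yk y y' show "y = y'"
      by (intro PiE_ext[OF y y']) (metis lessThan_iff less_Suc_eq)
  qed
  then show ?case by blast
qed

lemma exists_additive_basis:
  assumes p: "prime p" and char: "CHAR('a::{comm_ring_1, finite}) = p"
    and card: "CARD('a) = p ^ N"
  shows "\<exists>b :: nat \<Rightarrow> 'a.
    bij_betw (\<lambda>y. \<Sum>l<N. of_nat (y l) * b l) (PiE {..<N} (\<lambda>_. {..<p})) UNIV"
proof -
  obtain b :: "nat \<Rightarrow> 'a" where
    inj: "inj_on (\<lambda>y. \<Sum>l<N. of_nat (y l) * b l) (PiE {..<N} (\<lambda>_. {..<p}))"
    using exists_independent_family[OF assms order_refl] by blast
  have "(\<lambda>y. \<Sum>l<N. of_nat (y l) * b l) ` PiE {..<N} (\<lambda>_. {..<p}) = UNIV"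
    using card_image[OF inj] card by (intro card_subset_eq) (auto simp: card_PiE)
  with inj show ?thesis
    unfolding bij_betw_def by blast
qed

text \<open>Expanding each spanning element in the basis with fixed natural coefficients
  \<open>\<kappa>\<close> keeps the degree and makes vanishing a coordinatewise condition.\<close>

lemma lift_deg_coordinates:
  fixes b :: "nat \<Rightarrow> 'a::{comm_ring_1, finite}" and g :: "('i \<Rightarrow> nat) \<Rightarrow> 'a"
  assumes p: "prime p" and char: "CHAR('a) = p"
    and bij: "bij_betw (\<lambda>y. \<Sum>l<N. of_nat (y l) * b l) (PiE {..<N} (\<lambda>_. {..<p})) UNIV"
    and "lift_deg d g"
  shows "\<exists>G. (\<forall>l. deg_lt (Suc d) (\<lambda>y. int (G l y))) \<and> (\<forall>y. g y = 0 \<longleftrightarrow> (\<forall>l<N. p dvd G l y))"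
proof -
  obtain F where F: "\<And>c. deg_lt (Suc d) (\<lambda>y. int (F c y))" "\<And>y. g y = (\<Sum>c\<in>UNIV. of_nat (F c y) * c)"
    using assms(4) unfolding lift_deg_def by blast
  have "\<exists>y. c = (\<Sum>l<N. of_nat (y l) * b l)" for c
    using bij unfolding bij_betw_def by (metis (no_types, lifting) UNIV_I imageE)
  then obtain \<kappa> :: "'a \<Rightarrow> nat \<Rightarrow> nat" where \<kappa>: "\<And>c. c = (\<Sum>l<N. of_nat (\<kappa> c l) * b l)"
    by metis
  define G where "G l y = (\<Sum>c\<in>UNIV. F c y * \<kappa> c l)" for l y
  have deg: "deg_lt (Suc d) (\<lambda>y. int (G l y))" for l
  proof -
    have "deg_lt (Suc d) (\<lambda>y. \<Sum>c\<in>UNIV. int (\<kappa> c l) * int (F c y))"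
      by (intro deg_lt_sum deg_lt_cmult F)
    then show ?thesis
      by (simp add: G_def mult.commute del: deg_lt.simps)
  qed
  have g: "g y = (\<Sum>l<N. of_nat (G l y) * b l)" for y
  proof -
    have "g y = (\<Sum>c\<in>UNIV. of_nat (F c y) * (\<Sum>l<N. of_nat (\<kappa> c l) * b l))"
      using F(2) \<kappa> by simp
    also have "\<dots> = (\<Sum>c\<in>UNIV. \<Sum>l<N. of_nat (F c y * \<kappa> c l) * b l)"
      by (simp add: sum_distrib_left mult.assoc)
    also have "\<dots> = (\<Sum>l<N. of_nat (G l y) * b l)"
      by (subst sum.swap) (simp add: G_def sum_distrib_right)
    finally show ?thesis .
  qed
  have "g y = 0 \<longleftrightarrow> (\<forall>l<N. p dvd G l y)" for y
  proof
    assume "\<forall>l<N. p dvd G l y"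
    then have "of_nat (G l y) = (0 :: 'a)" if "l < N" for l
      using that by (simp add: of_nat_eq_0_iff_char_dvd char)
    then show "g y = 0"
      by (simp add: g)
  next
    assume "g y = 0"
    \<comment> \<open>Reduction modulo \<open>p\<close> moves the coordinates into the box, where
      injectivity permits comparison with the zero vector.\<close>
    then have "(\<Sum>l<N. of_nat (restrict (\<lambda>l. G l y mod p) {..<N} l) * b l)
      = (\<Sum>l<N. of_nat (restrict (\<lambda>l. 0) {..<N} l) * b l)"
      by (simp add: g of_nat_mod_CHAR[where 'a = 'a, unfolded char])
    then have "restrict (\<lambda>l. G l y mod p) {..<N} = restrict (\<lambda>l. 0) {..<N}"
      by (rule inj_onD[OF bij_betw_imp_inj_on[OF bij]]) (use prime_gt_0_nat[OF p] in \<open>auto split: if_splits\<close>)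
    then have "G l y mod p = 0" if "l < N" for l
      using that by (metis lessThan_iff restrict_apply')
    then show "\<forall>l<N. p dvd G l y"
      by auto
  qed
  with deg show ?thesis
    by blast
qed

section \<open>Counting common zeros in coordinates\<close>

lemma bij_betw_box_vectors:
  fixes b :: "nat \<Rightarrow> 'a::comm_ring_1"
  assumes bij: "bij_betw (\<lambda>y. \<Sum>l<N. of_nat (y l) * b l) (PiE {..<N} (\<lambda>_. {..<p})) UNIV"
  shows "bij_betw (\<lambda>y v. \<Sum>l<N. of_nat (y (v, l)) * b l)
    (PiE (UNIV \<times> {..<N}) (\<lambda>_. {..<p})) (UNIV :: ('n \<Rightarrow> 'a) set)"
  unfolding bij_betw_def
proof (intro conjI)
  show "inj_on (\<lambda>y (v :: 'n). \<Sum>l<N. of_nat (y (v, l)) * b l) (PiE (UNIV \<times> {..<N}) (\<lambda>_. {..<p}))"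
  proof (rule inj_onI)
    fix y y' :: "'n \<times> nat \<Rightarrow> nat"
    assume y: "y \<in> PiE (UNIV \<times> {..<N}) (\<lambda>_. {..<p})"
      and y': "y' \<in> PiE (UNIV \<times> {..<N}) (\<lambda>_. {..<p})"
      and eq: "(\<lambda>v. \<Sum>l<N. of_nat (y (v, l)) * b l) = (\<lambda>v. \<Sum>l<N. of_nat (y' (v, l)) * b l)"
    have "y (v, l) = y' (v, l)" if "l < N" for v l
    proof -
      have "(\<Sum>l<N. of_nat (restrict (\<lambda>l. y (v, l)) {..<N} l) * b l)
        = (\<Sum>l<N. of_nat (restrict (\<lambda>l. y' (v, l)) {..<N} l) * b l)"
        using fun_cong[OF eq, of v] by simp
      then have "restrict (\<lambda>l. y (v, l)) {..<N} = restrict (\<lambda>l. y' (v, l)) {..<N}"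
        by (rule inj_onD[OF bij_betw_imp_inj_on[OF bij]]) (use y y' in auto)
      then show ?thesis
        using that by (metis lessThan_iff restrict_apply')
    qed
    then show "y = y'"
      by (intro PiE_ext[OF y y']) auto
  qed
  show "(\<lambda>y (v :: 'n). \<Sum>l<N. of_nat (y (v, l)) * b l) ` PiE (UNIV \<times> {..<N}) (\<lambda>_. {..<p}) = UNIV"
  proof (intro equalityI subsetI UNIV_I)
    fix x :: "'n \<Rightarrow> 'a"
    have "\<exists>y\<in>PiE {..<N} (\<lambda>_. {..<p}). x v = (\<Sum>l<N. of_nat (y l) * b l)" for v
      using bij unfolding bij_betw_def by (metis (no_types, lifting) UNIV_I imageE)
    then obtain y where y: "\<And>v. y v \<in> PiE {..<N} (\<lambda>_. {..<p})"
      and x: "\<And>v. x v = (\<Sum>l<N. of_nat (y v l) * b l)"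
      by metis
    show "x \<in> (\<lambda>y v. \<Sum>l<N. of_nat (y (v, l)) * b l) ` PiE (UNIV \<times> {..<N}) (\<lambda>_. {..<p})"
      using y by (intro image_eqI[of _ _ "restrict (\<lambda>(v, l). y v l) (UNIV \<times> {..<N})"])
        (auto simp: x fun_eq_iff PiE_iff)
  qed
qed

text \<open>Each polynomial becomes \<open>N\<close> equations in \<open>N * CARD('n)\<close>
  coordinates. The degree sum is thus multiplied by \<open>N\<close>, but the maximal degree is
  not.\<close>

lemma zero_count_dvd:
  fixes p N r q m :: nat
    and f :: "nat \<Rightarrow> ('n::finite, 'a::{comm_ring_1, finite}) mvpoly"
  assumes p: "prime p" and char: "CHAR('a) = p" and card: "CARD('a) = p ^ N"
    and "m > 0" and m: "\<And>j. j \<in> {1..r} \<Longrightarrow> p_weight_degree p (f j) \<le> m"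
    and q: "q > 0 \<Longrightarrow> N * (\<Sum>j=1..r. p_weight_degree p (f j)) + m * (q - 1) < N * CARD('n)"
  shows "p ^ q dvd card {x. \<forall>j\<in>{1..r}. mvpoly_eval (f j) x = 0}"
proof -
  obtain b :: "nat \<Rightarrow> 'a" where
    b: "bij_betw (\<lambda>y. \<Sum>l<N. of_nat (y l) * b l) (PiE {..<N} (\<lambda>_. {..<p})) UNIV"
    using exists_additive_basis[OF p char card] by blast
  define \<Phi> :: "('n \<times> nat \<Rightarrow> nat) \<Rightarrow> 'n \<Rightarrow> 'a"
    where "\<Phi> y v = (\<Sum>l<N. of_nat (y (v, l)) * b l)" for y v
  let ?I = "UNIV \<times> {..<N} :: ('n \<times> nat) set"
  let ?B = "PiE ?I (\<lambda>_. {..<p}) :: ('n \<times> nat \<Rightarrow> nat) set"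
  let ?T = "{1..r} \<times> {..<N}"
  have \<Phi>: "bij_betw \<Phi> ?B UNIV"
    unfolding \<Phi>_def[abs_def] by (rule bij_betw_box_vectors[OF b])
  have "\<exists>G. (\<forall>l. deg_lt (Suc (p_weight_degree p (f j))) (\<lambda>y. int (G l y))) \<and>
      (\<forall>y. mvpoly_eval (f j) (\<Phi> y) = 0 \<longleftrightarrow> (\<forall>l<N. p dvd G l y))" for j
    unfolding \<Phi>_def[abs_def] by (intro lift_deg_coordinates[OF p char b] lift_deg_mvpoly_eval p char)
  then obtain G where
    deg: "\<And>j l. deg_lt (Suc (p_weight_degree p (f j))) (\<lambda>y. int (G j l y))" and
    zero: "\<And>j y. mvpoly_eval (f j) (\<Phi> y) = 0 \<longleftrightarrow> (\<forall>l<N. p dvd G j l y)"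
    by metis
  have "(\<Sum>t\<in>?T. p_weight_degree p (f (fst t))) = N * (\<Sum>j=1..r. p_weight_degree p (f j))"
    by (simp add: sum.cartesian_product[symmetric, of "\<lambda>j l. p_weight_degree p (f j)", simplified case_prod_unfold] sum_distrib_left)
  then have "p ^ q dvd card {y \<in> ?B. \<forall>t\<in>?T. p dvd G (fst t) (snd t) y}"
    using deg m q
    by (intro box_zero_count_dvd[OF p _ _ \<open>m > 0\<close>, where d = "\<lambda>t. p_weight_degree p (f (fst t))"])
       (auto simp: card_cartesian_product mult.commute simp del: deg_lt.simps)
  also have "card {y \<in> ?B. \<forall>t\<in>?T. p dvd G (fst t) (snd t) y}
    = card {x. \<forall>j\<in>{1..r}. mvpoly_eval (f j) x = 0}"
  proof (rule bij_betw_same_card[of \<Phi>], rule bij_betw_subset[OF \<Phi>])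
    show "\<Phi> ` {y \<in> ?B. \<forall>t\<in>?T. p dvd G (fst t) (snd t) y} = {x. \<forall>j\<in>{1..r}. mvpoly_eval (f j) x = 0}"
    proof (intro equalityI subsetI)
      fix x assume x: "x \<in> {x. \<forall>j\<in>{1..r}. mvpoly_eval (f j) x = 0}"
      obtain y where "y \<in> ?B" "x = \<Phi> y"
        using \<Phi> unfolding bij_betw_def by (metis UNIV_I imageE)
      with x zero show "x \<in> \<Phi> ` {y \<in> ?B. \<forall>t\<in>?T. p dvd G (fst t) (snd t) y}"
        by auto
    qed (use zero in auto)
  qed auto
  finally show ?thesis .
qed

lemma p_weight_eq_0D:
  assumes "p > 1" "p_weight p d = 0"
  shows "d = 0"
proof -
  have digits: "\<forall>i\<in>{..d}. (d div p ^ i) mod p = 0"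
    using assms(2) unfolding p_weight_def by (simp only: sum_eq_0_iff finite_atMost)
  have "d = (\<Sum>i\<le>d. (d div p ^ i) mod p * p ^ i)"
    using sum_base_digits[OF assms(1)] by (rule sym)
  also have "\<dots> = 0"
    using digits by (intro sum.neutral ballI) (simp only: mult_0)
  finally show ?thesis .
qed

text \<open>Settles the zero denominator: only the zero exponent vector can occur, so
  \<open>f\<close> is a nonzero constant.\<close>

lemma mvpoly_eval_p_weight_degree_0:
  fixes f :: "('n::finite, 'a::comm_ring_1) mvpoly"
  assumes "prime p" "f \<noteq> 0" "p_weight_degree p f = 0"
  shows "mvpoly_eval f x \<noteq> 0"
proof -
  have "m = 0" if m: "m \<in> Poly_Mapping.keys f" for m
  proof -
    have "monom_p_weight p m \<le> p_weight_degree p f"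
      unfolding p_weight_degree_def using m by (intro Max_ge) auto
    then have "p_weight p (Poly_Mapping.lookup m v) = 0" for v
      using assms(3) by (simp add: monom_p_weight_def)
    then have "Poly_Mapping.lookup m v = 0" for v
      using p_weight_eq_0D prime_gt_1_nat[OF assms(1)] by blast
    then show ?thesis
      by (intro poly_mapping_eqI) simp
  qed
  moreover have "Poly_Mapping.keys f \<noteq> {}"
    using assms(2) by simp
  ultimately have keys: "Poly_Mapping.keys f = {0}"
    by blast
  then have "Poly_Mapping.lookup f 0 \<noteq> 0"
    by (metis in_keys_iff singletonI)
  with keys show ?thesis
    by (simp add: mvpoly_eval_def)
qed

theorem theorem4p4:
  fixes p N r :: nat
    and f :: "nat \<Rightarrow> ('n::finite, 'a::{comm_ring_1, finite}) mvpoly"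
    and Z :: "('n \<Rightarrow> 'a) set"
  assumes "prime p"
    and "CHAR('a) = p"
    and "CARD('a) = p ^ N"
    and "r > 0"
    and "\<And>j. j \<in> {1..r} \<Longrightarrow> f j \<noteq> 0"
    and "Z = {x. \<forall>j\<in>{1..r}. mvpoly_eval (f j) x = 0}"
  shows "ord_p p (int (card Z)) \<ge>
           ceil_quotient
             (int N * (int CARD('n) - (\<Sum>j=1..r. int (p_weight_degree p (f j)))))
             (MAX j\<in>{1..r}. p_weight_degree p (f j))"
proof -
  define m where "m = (MAX j\<in>{1..r}. p_weight_degree p (f j))"
  define A where "A = int N * (int CARD('n) - (\<Sum>j=1..r. int (p_weight_degree p (f j))))"
  have le: "p_weight_degree p (f j) \<le> m" if "j \<in> {1..r}" for j
    unfolding m_def using that by (intro Max_ge) auto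
  have "ord_p p (int (card Z)) \<ge> ceil_quotient A m"
  proof (cases "card Z = 0")
    case True
    then show ?thesis by (simp add: ord_p_def)
  next
    case False
    have "m > 0"
    proof (rule ccontr)
      assume "\<not> m > 0"
      then have "mvpoly_eval (f 1) x \<noteq> 0" for x
        using le[of 1] assms(1,4,5) by (intro mvpoly_eval_p_weight_degree_0) auto
      then have "Z = {}"
        using assms(4,6) by fastforce
      with False show False by simp
    qed
    \<comment> \<open>A negative ceiling becomes \<open>q = 0\<close>, where divisibility is
      trivial; the bound then follows since multiplicities are nonnegative.\<close>
    define q where "q = nat \<lceil>real_of_int A / real m\<rceil>"
    have "p ^ q dvd card Z"
      unfolding assms(6)
    proof (rule zero_count_dvd[OF assms(1-3) \<open>m > 0\<close> le])
      assume "q > 0"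
      \<comment> \<open>For \<open>q > 0\<close> nothing was truncated, and the ceiling exceeds
        \<open>A / m\<close> by less than 1.\<close>
      then have "real_of_int (int q - 1) < real_of_int A / real m"
        unfolding q_def by linarith
      then have "real_of_int (int m * (int q - 1)) < real_of_int A"
        using \<open>m > 0\<close> by (simp add: pos_less_divide_eq mult.commute)
      then have "int m * (int q - 1) < A"
        by (simp only: of_int_less_iff)
      moreover have "int (q - 1) = int q - 1"
        using \<open>q > 0\<close> by simp
      ultimately have "int (N * (\<Sum>j=1..r. p_weight_degree p (f j)) + m * (q - 1)) < int (N * CARD('n))"
        unfolding A_def of_nat_add of_nat_mult of_nat_sum by (simp add: right_diff_distrib)
      then show "N * (\<Sum>j=1..r. p_weight_degree p (f j)) + m * (q - 1) < N * CARD('n)"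
        by (simp only: of_nat_less_iff)
    qed
    then have "int p ^ q dvd int (card Z)"
      by (metis of_nat_dvd_iff of_nat_power)
    then have "q \<le> multiplicity (int p) (int (card Z))"
      using False assms(1) prime_gt_1_nat by (intro multiplicity_geI) auto
    then have "real_of_int \<lceil>real_of_int A / real m\<rceil> \<le> real (multiplicity (int p) (int (card Z)))"
      unfolding q_def by linarith
    then show ?thesis
      using False \<open>m > 0\<close> by (simp add: ceil_quotient_def ord_p_def)
  qed
  then show ?thesis
    by (simp add: A_def m_def)
qed

end
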